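(* There is a $\Delta^1_1$ function $K:{}^3({}^\omega2)\to{}^\omega2$ such that for every $\Sigma^1_1$ set $A\subseteq{}^\omega2$ with $E_0\le_{\Delta^1_1}E_0\upharpoonright A$, the restriction $K\upharpoonright[A]^3_{E_0}$ is not continuous.
   Context: $E_0$ on ${}^\omega2$: $x\,E_0\,y$ iff $(\exists n)(\forall k>n)(x(k)=y(k))$. $[A]^3_{E_0}=\{(x_0,x_1,x_2)\in{}^3A:(\forall i\neq j)\neg(x_i\,E_0\,x_j)\}$ with the subspace topology. $E\le_{\Delta^1_1}F$ means there is a $\Delta^1_1$ function $\Phi$ with $a\,E\,b\iff\Phi(a)\,F\,\Phi(b)$. *)

theory Defs
  imports "HOL-Analysis.Analysis"
begin

text \<open>
  \<open>nat \<Rightarrow> bool\<close> and \<open>nat \<Rightarrow> nat\<close> carry the library's product topology over discrete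
  factors, i.e. they are Cantor space and Baire space as topological spaces.
\<close>

type_synonym cantor = "nat \<Rightarrow> bool"
type_synonym baire = "nat \<Rightarrow> nat"

text \<open>
  The pointclasses are the boldface ones. The definitions are polymorphic in the ambient
  space but are meant for Polish spaces only; outside of these they need not be well behaved.
\<close>

definition Sigma11 :: "'a::topological_space set \<Rightarrow> bool" where
  "Sigma11 A \<longleftrightarrow> (\<exists>C :: ('a \<times> baire) set. closed C \<and> A = fst ` C)"

definition Pi11 :: "'a::topological_space set \<Rightarrow> bool" where
  "Pi11 A \<longleftrightarrow> Sigma11 (- A)"

definition Delta11 :: "'a::topological_space set \<Rightarrow> bool" where
  "Delta11 A \<longleftrightarrow> Sigma11 A \<and> Pi11 A"

text \<open>A (total) function is \<open>\<Delta>\<^sup>1\<^sub>1\<close> if it is so as a set of pairs.\<close>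

definition Delta11_fun :: "('a::topological_space \<Rightarrow> 'b::topological_space) \<Rightarrow> bool" where
  "Delta11_fun f \<longleftrightarrow> Delta11 {(x, y). y = f x}"

definition E0 :: "cantor rel" where
  "E0 = {(x, y). \<exists>n. \<forall>k>n. x k = y k}"

text \<open>
  In \<open>Delta11_reducible E F\<close>, \<open>E\<close> is an equivalence relation on the whole type, while \<open>F\<close> may
  be an equivalence relation on a proper subset, such as \<open>Restr E0 A\<close> (\<open>E0 \<inter> A \<times> A\<close>) for
  the restriction of \<open>E0\<close> to \<open>A\<close>. By reflexivity of \<open>E\<close>, a reduction then takes all its
  values in the domain of \<open>F\<close>.
\<close>

definition Delta11_reducible ::
  "'a::topological_space rel \<Rightarrow> 'b::topological_space rel \<Rightarrow> bool" where
  "Delta11_reducible E F \<longleftrightarrow>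
     (\<exists>\<Phi>. Delta11_fun \<Phi> \<and> (\<forall>a b. (a, b) \<in> E \<longleftrightarrow> (\<Phi> a, \<Phi> b) \<in> F))"

text \<open>For symmetric \<open>E\<close>, the three conditions below cover all pairs of distinct indices.\<close>

definition triples :: "'a rel \<Rightarrow> 'a set \<Rightarrow> ('a \<times> 'a \<times> 'a) set" where
  "triples E A = {(x0, x1, x2). x0 \<in> A \<and> x1 \<in> A \<and> x2 \<in> A \<and>
     (x0, x1) \<notin> E \<and> (x0, x2) \<notin> E \<and> (x1, x2) \<notin> E}"

end

theory Submission
  imports Defs
begin

text \<open>
  Let \<open>K(x, y, z)\<close> record, as a constant sequence, whether \<open>x(n) = y(n) \<noteq> z(n)\<close> for infinitely
  many \<open>n\<close>. This is \<open>E\<^sub>0\<close>-invariant in each variable. A reduction \<open>f\<close> of \<open>E\<^sub>0\<close> to \<open>E\<^sub>0\<restriction>A\<close> is continuous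
  on an \<open>E\<^sub>0\<close>-invariant dense \<open>G\<^sub>\<delta>\<close> set \<open>G\<close>. As \<open>E\<^sub>0\<close>-classes are dense, continuity of \<open>K\<close> on the triples of
  \<open>A\<close> would make \<open>K(f(x), f(y), f(z))\<close> the same for all inequivalent \<open>x, y, z \<in> G\<close>. However, starting from
  any \<open>z \<in> G\<close> one can flip sparse bits, alternately in \<open>x\<close> and in \<open>y\<close>, so that \<open>x, y \<in> G\<close> and
  \<open>f(x)\<close>, \<open>f(y)\<close> differ from \<open>f(z)\<close> on almost disjoint sets: then the value at \<open>(x, y, z)\<close> is false. Its
  cyclic shift \<open>(y, z, x)\<close> gives true, because \<open>f(x)\<close> and \<open>f(z)\<close> differ infinitely often and \<open>f(y)\<close>
  almost always agrees with \<open>f(z)\<close> where they do.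
\<close>

section \<open>Cylinders\<close>

lemma open_contains_cylinder:
  fixes S :: "(nat \<Rightarrow> 'a::topological_space) set"
  assumes "open S" "x \<in> S"
  obtains m where "\<And>w. (\<And>i. i < m \<Longrightarrow> w i = x i) \<Longrightarrow> w \<in> S"
proof -
  obtain X where X: "x \<in> (\<Pi>\<^sub>E i\<in>UNIV. X i)" "finite {i. X i \<noteq> UNIV}" "(\<Pi>\<^sub>E i\<in>UNIV. X i) \<subseteq> S"
    using product_topology_open_contains_basis[of "\<lambda>_. euclidean" UNIV S x] assms
    unfolding open_fun_def by auto
  obtain m where m: "\<And>i. X i \<noteq> UNIV \<Longrightarrow> i < m"
    using X(2) unfolding finite_nat_set_iff_bounded by auto
  show thesis
  proof (rule that[of m])
    fix w assume w: "\<And>i. i < m \<Longrightarrow> w i = x i"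
    have "w i \<in> X i" for i
      using X(1) m[of i] w[of i] by (cases "X i = UNIV") (auto simp: PiE_iff)
    then show "w \<in> S"
      using X(3) by (auto simp: PiE_iff)
  qed
qed

lemma continuous_on_discrete_cylinder:
  fixes f :: "(nat \<Rightarrow> 'a::topological_space) \<Rightarrow> 'b::discrete_topology"
  assumes "continuous_on G f" "x \<in> G"
  obtains m where "\<And>w. w \<in> G \<Longrightarrow> (\<And>i. i < m \<Longrightarrow> w i = x i) \<Longrightarrow> f w = f x"
proof -
  obtain A where A: "open A" "A \<inter> G = f -` {f x} \<inter> G"
    using assms(1) open_discrete[of "{f x}"] unfolding continuous_on_open_invariant by blast
  moreover have "x \<in> A"
    using A assms(2) by blast
  ultimately obtain m where m: "\<And>w. (\<And>i. i < m \<Longrightarrow> w i = x i) \<Longrightarrow> w \<in> A"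
    using open_contains_cylinder by blast
  show thesis
  proof (rule that[of m])
    fix w assume "w \<in> G" "\<And>i. i < m \<Longrightarrow> w i = x i"
    then have "w \<in> A \<inter> G"
      using m by blast
    then show "f w = f x"
      using A(2) by blast
  qed
qed

lemma continuous_on_cantor_cylinder:
  fixes f :: "(nat \<Rightarrow> 'a::topological_space) \<Rightarrow> nat \<Rightarrow> 'b::discrete_topology"
  assumes "continuous_on G f" "x \<in> G"
  obtains m where "\<And>w n. w \<in> G \<Longrightarrow> (\<And>i. i < m \<Longrightarrow> w i = x i) \<Longrightarrow> n < a \<Longrightarrow> f w n = f x n"
proof -
  have "\<exists>m. \<forall>w\<in>G. (\<forall>i<m. w i = x i) \<longrightarrow> f w n = f x n" for n
    using continuous_on_discrete_cylinder[OF continuous_on_product_then_coordinatewise[OF assms(1), of n] assms(2)]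
    by metis
  then obtain m where m: "\<And>n w. w \<in> G \<Longrightarrow> (\<forall>i<m n. w i = x i) \<Longrightarrow> f w n = f x n"
    by metis
  \<comment> \<open>For \<open>a = 0\<close> the maximum is taken over the empty set and is
    unspecified, but then there is no \<open>n < a\<close> to consider.\<close>
  show thesis
  proof (rule that[of "Max (m ` {..<a})"])
    fix w n assume w: "w \<in> G" "\<And>i. i < Max (m ` {..<a}) \<Longrightarrow> w i = x i" and "n < a"
    have "m n \<le> Max (m ` {..<a})"
      using \<open>n < a\<close> by (intro Max_ge) auto
    then have "\<forall>i<m n. w i = x i"
      using w(2) by simp
    then show "f w n = f x n"
      by (rule m[OF w(1)])
  qed
qed

section \<open>Lusin separation\<close>

definition cyl :: "'a list \<Rightarrow> (nat \<Rightarrow> 'a) set" where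
  "cyl s = {a. \<forall>i<length s. a i = s ! i}"

lemma cyl_split: "cyl s = (\<Union>k. cyl (s @ [k]))"
  by (auto simp: cyl_def nth_append less_Suc_eq)

definition borel_separable :: "'a::topological_space set \<Rightarrow> 'a set \<Rightarrow> bool" where
  "borel_separable A B \<longleftrightarrow> (\<exists>S\<in>sets borel. A \<subseteq> S \<and> S \<inter> B = {})"

text \<open>Used contrapositively: if two countable unions cannot be separated, then neither can
  some pair of their pieces.\<close>

lemma borel_separable_UN:
  fixes A B :: "nat \<Rightarrow> 'a::topological_space set"
  assumes "\<And>i j. borel_separable (A i) (B j)"
  shows "borel_separable (\<Union>i. A i) (\<Union>j. B j)"
proof -
  obtain S where S: "\<And>i j. S i j \<in> sets borel" "\<And>i j. A i \<subseteq> S i j" "\<And>i j. S i j \<inter> B j = {}"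
    using assms unfolding borel_separable_def by metis
  show ?thesis
    unfolding borel_separable_def
  proof (intro bexI conjI)
    show "(\<Union>i. A i) \<subseteq> (\<Union>i. \<Inter>j. S i j)"
      using S(2) by blast
    show "(\<Union>i. \<Inter>j. S i j) \<inter> (\<Union>j. B j) = {}"
      using S(3) by blast
    show "(\<Union>i. \<Inter>j. S i j) \<in> sets borel"
      using S(1) by (intro sets.countable_UN sets.countable_INT image_subsetI) auto
  qed
qed

text \<open>Otherwise inseparability passes to ever longer cylinders on both sides. These shrink to
  points \<open>a\<close> and \<open>b\<close>, which lie in \<open>C\<close> and \<open>D\<close>
  by closedness, and \<open>f a\<close> and \<open>g b\<close> have disjoint open neighbourhoods. By
  continuity, one of these already separates the images of small enough cylinders.\<close>

theorem Lusin_separation: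
  fixes f g :: "baire \<Rightarrow> nat \<Rightarrow> 'a::t2_space"
  assumes f: "continuous_on C f" "closed C" and g: "continuous_on D g" "closed D"
    and disj: "f ` C \<inter> g ` D = {}"
  shows "borel_separable (f ` C) (g ` D)"
proof (rule ccontr)
  define F where "F s = f ` (C \<inter> cyl s)" for s
  define H where "H s = g ` (D \<inter> cyl s)" for s
  assume "\<not> borel_separable (f ` C) (g ` D)"
  then have init: "\<not> borel_separable (F []) (H [])"
    by (simp add: F_def H_def cyl_def)
  have step: "\<exists>i j. \<not> borel_separable (F (s @ [i])) (H (t @ [j]))" if "\<not> borel_separable (F s) (H t)" for s t
  proof (rule ccontr)
    assume "\<not> ?thesis"
    then have "borel_separable (\<Union>i. F (s @ [i])) (\<Union>j. H (t @ [j]))"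
      by (intro borel_separable_UN) auto
    moreover have "F s = (\<Union>i. F (s @ [i]))" "H t = (\<Union>j. H (t @ [j]))"
      unfolding F_def H_def by (subst cyl_split, blast)+
    ultimately show False using that by simp
  qed
  have "\<exists>p. \<forall>n. (length (fst (p n)) = n \<and> length (snd (p n)) = n \<and>
        \<not> borel_separable (F (fst (p n))) (H (snd (p n)))) \<and>
      (\<exists>i j. p (Suc n) = (fst (p n) @ [i], snd (p n) @ [j]))"
  proof (rule dependent_nat_choice, goal_cases)
    case 1
    show ?case using init by (intro exI[of _ "([], [])"]) simp
  next
    case (2 p n)
    then obtain i j where "\<not> borel_separable (F (fst p @ [i])) (H (snd p @ [j]))"
      using step by blast
    with 2 show ?case by (intro exI[of _ "(fst p @ [i], snd p @ [j])"]) auto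
  qed
  then obtain p where len: "\<And>n. length (fst (p n)) = n" "\<And>n. length (snd (p n)) = n"
    and nsep: "\<And>n. \<not> borel_separable (F (fst (p n))) (H (snd (p n)))"
    and ext: "\<And>n. \<exists>i j. p (Suc n) = (fst (p n) @ [i], snd (p n) @ [j])"
    by blast
  define a where "a n = fst (p (Suc n)) ! n" for n
  define b where "b n = snd (p (Suc n)) ! n" for n
  have ab: "i < n \<Longrightarrow> fst (p n) ! i = a i \<and> snd (p n) ! i = b i" for i n
  proof (induction n)
    case (Suc n)
    show ?case
    proof (cases "i = n")
      case False
      then show ?thesis using Suc ext[of n] len[of n] by (auto simp: nth_append)
    qed (simp add: a_def b_def)
  qed simp
  \<comment> \<open>An empty image would be trivially separable, so every cylinder on the way meets
    \<open>C\<close> or \<open>D\<close>, respectively.\<close>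
  have ne: "\<exists>w\<in>C. \<forall>i<n. w i = a i" "\<exists>w\<in>D. \<forall>i<n. w i = b i" for n
  proof -
    have "F (fst (p n)) \<noteq> {}" "H (snd (p n)) \<noteq> {}"
      using nsep[of n] unfolding borel_separable_def by force+
    then show "\<exists>w\<in>C. \<forall>i<n. w i = a i" "\<exists>w\<in>D. \<forall>i<n. w i = b i"
      using ab len by (auto simp: F_def H_def cyl_def)
  qed
  have "a \<in> C"
  proof (rule ccontr)
    assume "a \<notin> C"
    then show False
      using open_contains_cylinder[of "- C" a] f(2) ne(1) by (metis ComplD ComplI open_Compl)
  qed
  have "b \<in> D"
  proof (rule ccontr)
    assume "b \<notin> D"
    then show False
      using open_contains_cylinder[of "- D" b] g(2) ne(2) by (metis ComplD ComplI open_Compl)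
  qed
  have "f a \<noteq> g b"
    using \<open>a \<in> C\<close> \<open>b \<in> D\<close> disj by blast
  then obtain i where "f a i \<noteq> g b i"
    by blast
  \<comment> \<open>Hausdorffness is assumed of the factor only, so the neighbourhoods are preimages
    under a coordinate at which the two points differ.\<close>
  then obtain U' V' where UV': "open U'" "open V'" "f a i \<in> U'" "g b i \<in> V'" "U' \<inter> V' = {}"
    using hausdorff by metis
  define U V where "U = (\<lambda>x. x i) -` U'" and "V = (\<lambda>x. x i) -` V'"
  have UV: "open U" "open V" "f a \<in> U" "g b \<in> V" "U \<inter> V = {}"
    using UV' by (auto simp: U_def V_def intro!: open_vimage continuous_on_product_coordinates)
  obtain A where A: "open A" "A \<inter> C = f -` U \<inter> C"
    using f(1) UV(1) unfolding continuous_on_open_invariant by blast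
  obtain B where B: "open B" "B \<inter> D = g -` V \<inter> D"
    using g(1) UV(2) unfolding continuous_on_open_invariant by blast
  have "a \<in> A" "b \<in> B"
    using A B UV \<open>a \<in> C\<close> \<open>b \<in> D\<close> by auto
  obtain m where m: "\<And>w. (\<And>i. i < m \<Longrightarrow> w i = a i) \<Longrightarrow> w \<in> A"
    using open_contains_cylinder[OF A(1) \<open>a \<in> A\<close>] by blast
  obtain m' where m': "\<And>w. (\<And>i. i < m' \<Longrightarrow> w i = b i) \<Longrightarrow> w \<in> B"
    using open_contains_cylinder[OF B(1) \<open>b \<in> B\<close>] by blast
  define n where "n = max m m'"
  have "F (fst (p n)) \<subseteq> U"
  proof
    fix y assume "y \<in> F (fst (p n))"
    then obtain w where w: "w \<in> C" "w \<in> cyl (fst (p n))" "y = f w"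
      unfolding F_def by blast
    then have "w i = a i" if "i < m" for i
      using that ab[of i n] len(1)[of n] by (simp add: cyl_def n_def)
    then have "w \<in> A \<inter> C"
      using m w(1) by blast
    then show "y \<in> U"
      using A(2) w(3) by blast
  qed
  moreover have "H (snd (p n)) \<subseteq> V"
  proof
    fix y assume "y \<in> H (snd (p n))"
    then obtain w where w: "w \<in> D" "w \<in> cyl (snd (p n))" "y = g w"
      unfolding H_def by blast
    then have "w i = b i" if "i < m'" for i
      using that ab[of i n] len(2)[of n] by (simp add: cyl_def n_def)
    then have "w \<in> B \<inter> D"
      using m' w(1) by blast
    then show "y \<in> V"
      using B(2) w(3) by blast
  qed
  ultimately have "F (fst (p n)) \<subseteq> U \<and> U \<inter> H (snd (p n)) = {}"
    using UV(5) by blast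
  then have "borel_separable (F (fst (p n))) (H (snd (p n)))"
    using borel_open[OF UV(1)] unfolding borel_separable_def by blast
  then show False using nsep by blast
qed

section \<open>Coordinates of \<open>\<Delta>\<^sup>1\<^sub>1\<close> functions are Borel\<close>

lemma continuous_on_compose_discrete:
  fixes f :: "'a::topological_space \<Rightarrow> 'b::discrete_topology" and P :: "'b \<Rightarrow> 'c::topological_space"
  assumes "continuous_on S f"
  shows "continuous_on S (\<lambda>x. P (f x))"
proof -
  have "continuous_on UNIV P"
    by (simp add: continuous_on_open_vimage open_discrete)
  then show ?thesis
    using continuous_on_compose2 assms by blast
qed

text \<open>Both \<open>{x. f x n}\<close> and its complement are projections of the graph with one
  output bit prescribed, hence disjoint analytic sets. A Borel set separating them must equal the
  first one.\<close>

lemma Delta11_fun_coordinate_borel: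
  fixes f :: "cantor \<Rightarrow> cantor"
  assumes "Delta11_fun f"
  shows "{x. f x n} \<in> sets borel"
proof -
  obtain C :: "((cantor \<times> cantor) \<times> baire) set"
    where C: "closed C" and graph: "{(x, y). y = f x} = fst ` C"
    using assms unfolding Delta11_fun_def Delta11_def Sigma11_def by blast
  \<comment> \<open>A single Baire point codes \<open>x\<close>, \<open>f x\<close> and the witness
    for the graph in its positions modulo 3, with the value 0 standing for \<open>True\<close>. Thus
    \<open>{x. f x n = b}\<close> becomes the image of the closed set \<open>D b\<close> under the
    continuous \<open>X\<close>, as \<open>Lusin_separation\<close> requires.\<close>
  define X :: "baire \<Rightarrow> cantor" where "X w = (\<lambda>i. w (3 * i) = 0)" for w
  define Y :: "baire \<Rightarrow> cantor" where "Y w = (\<lambda>i. w (3 * i + 1) = 0)" for w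
  define Z :: "baire \<Rightarrow> baire" where "Z w = (\<lambda>i. w (3 * i + 2))" for w
  define D where "D b = {w. ((X w, Y w), Z w) \<in> C \<and> Y w n = b}" for b
  have zero: "continuous_on UNIV (\<lambda>w :: baire. w k = 0)" for k
    using continuous_on_compose_discrete[OF continuous_on_product_coordinates[of k], of "\<lambda>j. j = 0"] .
  have cont: "continuous_on UNIV X" "continuous_on UNIV Y" "continuous_on UNIV Z"
    by (rule continuous_on_coordinatewise_then_product, simp add: X_def Y_def Z_def zero)+
  have closed_D: "closed (D b)" for b
  proof -
    have "closed ((\<lambda>w. ((X w, Y w), Z w)) -` C)"
      by (intro closed_vimage C continuous_on_Pair cont)
    moreover have "closed {w. Y w n = b}"
      by (intro closed_Collect_eq continuous_on_const continuous_on_product_then_coordinatewise[OF cont(2)])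
    ultimately show ?thesis
      unfolding D_def vimage_def by (rule closed_Collect_conj)
  qed
  have image_D: "X ` D b = {x. f x n = b}" for b
  proof (intro equalityI subsetI)
    fix x assume "x \<in> X ` D b"
    then obtain w where w: "x = X w" "((X w, Y w), Z w) \<in> C" "Y w n = b"
      by (auto simp: D_def)
    then have "(X w, Y w) \<in> {(x, y). y = f x}"
      unfolding graph by force
    then show "x \<in> {x. f x n = b}"
      using w by simp
  next
    fix x assume x: "x \<in> {x. f x n = b}"
    have "(x, f x) \<in> fst ` C"
      unfolding graph[symmetric] by simp
    then obtain c where c: "((x, f x), c) \<in> C"
      by auto
    define w where "w j = (if j mod 3 = 0 then of_bool (\<not> x (j div 3))
      else if j mod 3 = 1 then of_bool (\<not> f x (j div 3)) else c (j div 3))" for j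
    have "(3 * i + 1) mod 3 = 1" "(3 * i + 2) mod 3 = 2" "(3 * i + 1) div 3 = i" "(3 * i + 2) div 3 = i"
      for i :: nat
      by presburger+
    then have "X w = x" "Y w = f x" "Z w = c"
      by (auto simp: X_def Y_def Z_def w_def fun_eq_iff)
    with c x show "x \<in> X ` D b"
      by (intro image_eqI[of _ _ w]) (auto simp: D_def)
  qed
  have "borel_separable (X ` D True) (X ` D False)"
    by (intro Lusin_separation closed_D continuous_on_subset[OF cont(1)]) (auto simp: image_D)
  then obtain S where "S \<in> sets borel" "{x. f x n} \<subseteq> S" "S \<inter> {x. \<not> f x n} = {}"
    unfolding image_D borel_separable_def by auto
  moreover from this have "{x. f x n} = S"
    by blast
  ultimately show ?thesis
    by simp
qed

section \<open>Baire category\<close>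

definition residual :: "'a::topological_space set \<Rightarrow> bool" where
  "residual P \<longleftrightarrow> (\<exists>\<U>. countable \<U> \<and> (\<forall>U\<in>\<U>. open U \<and> closure U = UNIV) \<and> \<Inter>\<U> \<subseteq> P)"

lemma residual_mono: "residual P \<Longrightarrow> P \<subseteq> Q \<Longrightarrow> residual Q"
  unfolding residual_def by (meson subset_trans)

lemma residual_open: "open U \<Longrightarrow> closure U = UNIV \<Longrightarrow> residual U"
  unfolding residual_def by (intro exI[of _ "{U}"]) auto

lemma residual_INT:
  fixes P :: "nat \<Rightarrow> 'a::topological_space set"
  assumes "\<And>n. residual (P n)"
  shows "residual (\<Inter>n. P n)"
proof -
  obtain U where U: "\<And>n. countable (U n)" "\<And>n V. V \<in> U n \<Longrightarrow> open V \<and> closure V = UNIV" "\<And>n. \<Inter>(U n) \<subseteq> P n"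
    using assms unfolding residual_def by metis
  show ?thesis
    unfolding residual_def
  proof (intro exI conjI)
    show "countable (\<Union>n. U n)"
      using U(1) by blast
    show "\<forall>V\<in>\<Union>n. U n. open V \<and> closure V = UNIV"
      using U(2) by blast
    show "\<Inter>(\<Union>n. U n) \<subseteq> (\<Inter>n. P n)"
      using U(3) by blast
  qed
qed

lemma residual_Int:
  assumes "residual P" "residual Q"
  shows "residual (P \<inter> Q)"
proof -
  have "residual (\<Inter>n::nat. if n = 0 then P else Q)"
    using assms by (intro residual_INT) simp
  moreover have "(\<Inter>n::nat. if n = 0 then P else Q) \<subseteq> P \<inter> Q"
    using zero_neq_one[where 'a = nat] by (auto dest: spec[of _ "0::nat"] spec[of _ "1::nat"])
  ultimately show ?thesis
    by (rule residual_mono)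
qed

section \<open>The Baire property and continuity on residual sets\<close>

lemma closure_open_Un_interior_Compl: "closure (S \<union> interior (- S)) = UNIV"
proof -
  have "- closure S \<subseteq> closure (- closure S)"
    by (rule closure_subset)
  then show ?thesis
    unfolding closure_Un interior_complement by blast
qed

text \<open>Giving the complement its own open approximation makes the notion symmetric: the
  complement step of the Borel induction just swaps \<open>U\<close> and \<open>V\<close>, and both
  fibres of a bit-valued function come with open sets.\<close>

definition baire_property :: "'a::topological_space set \<Rightarrow> bool" where
  "baire_property S \<longleftrightarrow> (\<exists>U V. open U \<and> open V \<and> residual {x. (x \<in> S \<longleftrightarrow> x \<in> U) \<and> (x \<notin> S \<longleftrightarrow> x \<in> V)})"

text \<open>The interior of \<open>- U\<close> serves as \<open>V\<close>: together with
  \<open>U\<close> it misses only the boundary of \<open>U\<close>, which is nowhere dense.\<close>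

lemma baire_propertyI:
  assumes "open U" "residual {x. x \<in> S \<longleftrightarrow> x \<in> U}"
  shows "baire_property S"
proof -
  have "residual ({x. x \<in> S \<longleftrightarrow> x \<in> U} \<inter> (U \<union> interior (- U)))"
    by (intro residual_Int assms residual_open closure_open_Un_interior_Compl open_Un open_interior)
  then have "residual {x. (x \<in> S \<longleftrightarrow> x \<in> U) \<and> (x \<notin> S \<longleftrightarrow> x \<in> interior (- U))}"
    by (rule residual_mono) (use interior_subset[of "- U"] in blast)
  then show ?thesis
    unfolding baire_property_def using assms(1) open_interior by blast
qed

lemma borel_baire_property:
  assumes "S \<in> sets borel"
  shows "baire_property S"
proof -
  have "S \<in> sigma_sets UNIV {S. open S}"
    using assms by (simp add: borel_def)
  then show ?thesis
  proof induction
    case (Basic S)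
    then show ?case
      by (intro baire_propertyI[of S]) (auto intro: residual_mono residual_open[of UNIV])
  next
    case Empty
    show ?case
      by (intro baire_propertyI[of "{}"]) (auto intro: residual_mono residual_open[of UNIV])
  next
    case (Compl S)
    then obtain U V where "open U" "open V" "residual {x. (x \<in> S \<longleftrightarrow> x \<in> U) \<and> (x \<notin> S \<longleftrightarrow> x \<in> V)}"
      unfolding baire_property_def by blast
    then show ?case
      by (intro baire_propertyI[of V]) (auto elim!: residual_mono)
  next
    case (Union S)
    then obtain U where U: "\<And>n. open (U n)" "\<And>n. residual {x. x \<in> S n \<longleftrightarrow> x \<in> U n}"
      unfolding baire_property_def by (metis (no_types, lifting) residual_mono Collect_mono)
    have "residual (\<Inter>n. {x. x \<in> S n \<longleftrightarrow> x \<in> U n})"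
      using U(2) by (rule residual_INT)
    then have "residual {x. x \<in> (\<Union>n. S n) \<longleftrightarrow> x \<in> (\<Union>n. U n)}"
      by (rule residual_mono) blast
    then show ?case
      using U(1) by (intro baire_propertyI[of "\<Union>n. U n"]) auto
  qed
qed

text \<open>Discarding a meager set for each coordinate makes both fibres of that coordinate
  relatively open, and countably many coordinates leave a residual set.\<close>

lemma borel_continuous_on_residual:
  fixes f :: "'a::topological_space \<Rightarrow> cantor"
  assumes "\<And>n. {x. f x n} \<in> sets borel"
  obtains P where "residual P" "continuous_on P f"
proof -
  define Q where "Q n U V \<longleftrightarrow> open U \<and> open V \<and>
    residual {x. (f x n \<longleftrightarrow> x \<in> U) \<and> (\<not> f x n \<longleftrightarrow> x \<in> V)}" for n U V
  have "\<exists>U V. Q n U V" for n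
    using borel_baire_property[OF assms, of n] by (simp add: baire_property_def Q_def)
  then obtain U V where "\<And>n. Q n (U n) (V n)"
    by metis
  then have UV: "\<And>n. open (U n)" "\<And>n. open (V n)"
    "\<And>n. residual {x. (f x n \<longleftrightarrow> x \<in> U n) \<and> (\<not> f x n \<longleftrightarrow> x \<in> V n)}"
    by (simp_all add: Q_def)
  define P where "P = (\<Inter>n. {x. (f x n \<longleftrightarrow> x \<in> U n) \<and> (\<not> f x n \<longleftrightarrow> x \<in> V n)})"
  have "continuous_on P (\<lambda>x. f x n)" for n
    unfolding continuous_on_open_invariant
  proof (intro allI impI)
    fix B :: "bool set"
    define A where "A = (if True \<in> B then U n else {}) \<union> (if False \<in> B then V n else {})"
    have "open A"
      using UV(1,2)[of n] by (simp add: A_def open_Un)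
    moreover have "x \<in> A \<longleftrightarrow> f x n \<in> B" if "x \<in> P" for x
      using that by (cases "f x n") (auto simp: P_def A_def)
    ultimately show "\<exists>A. open A \<and> A \<inter> P = (\<lambda>x. f x n) -` B \<inter> P"
      by blast
  qed
  moreover have "residual P"
    unfolding P_def using UV(3) by (rule residual_INT)
  ultimately show thesis
    using that continuous_on_coordinatewise_then_product by blast
qed

section \<open>Invariant residual sets\<close>

definition flip :: "nat set \<Rightarrow> cantor \<Rightarrow> cantor" where
  "flip F x = (\<lambda>i. x i \<noteq> (i \<in> F))"

lemma flip_flip [simp]: "flip F (flip F x) = x"
  by (auto simp: flip_def)

lemma continuous_flip: "continuous_on UNIV (flip F)"
proof (rule continuous_on_coordinatewise_then_product)
  show "continuous_on UNIV (\<lambda>x. flip F x i)" for i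
    unfolding flip_def
    by (rule continuous_on_compose_discrete[OF continuous_on_product_coordinates, of "\<lambda>b. b \<noteq> (i \<in> F)"])
qed

lemma E0_iff_flip: "(x, y) \<in> E0 \<longleftrightarrow> (\<exists>F. finite F \<and> y = flip F x)"
proof
  assume "(x, y) \<in> E0"
  then obtain n where n: "\<And>k. k > n \<Longrightarrow> x k = y k"
    by (auto simp: E0_def)
  have "{i. x i \<noteq> y i} \<subseteq> {..n}"
    using n by (auto simp: not_le[symmetric])
  then have "finite {i. x i \<noteq> y i}"
    by (rule finite_subset) simp
  moreover have "y = flip {i. x i \<noteq> y i} x"
    by (auto simp: flip_def)
  ultimately show "\<exists>F. finite F \<and> y = flip F x"
    by blast
next
  assume "\<exists>F. finite F \<and> y = flip F x"
  then obtain F n where F: "y = flip F x" "\<And>i. i \<in> F \<Longrightarrow> i < n"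
    by (auto simp: finite_nat_set_iff_bounded)
  then have "\<forall>k>n. x k = y k"
    by (metis flip_def less_asym)
  then show "(x, y) \<in> E0"
    by (auto simp: E0_def)
qed

lemma E0_iff_finite: "(x, y) \<in> E0 \<longleftrightarrow> finite {i. x i \<noteq> y i}"
proof -
  have "{i. x i \<noteq> flip F x i} = F" for F
    by (auto simp: flip_def)
  moreover have "y = flip {i. x i \<noteq> y i} x"
    by (auto simp: flip_def)
  ultimately show ?thesis
    unfolding E0_iff_flip by metis
qed

lemma E0_sym: "(x, y) \<in> E0 \<Longrightarrow> (y, x) \<in> E0"
  by (simp add: E0_iff_finite eq_commute)

lemma E0_trans: "(x, y) \<in> E0 \<Longrightarrow> (y, z) \<in> E0 \<Longrightarrow> (x, z) \<in> E0"
  unfolding E0_iff_finite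
  by (rule finite_subset[of _ "{i. x i \<noteq> y i} \<union> {i. y i \<noteq> z i}"]) auto

text \<open>\<open>flip F\<close> is a homeomorphism, being continuous and its own inverse.\<close>

lemma dense_vimage_flip:
  assumes "open U" "closure U = UNIV"
  shows "open (flip F -` U)" "closure (flip F -` U) = UNIV"
proof -
  show "open (flip F -` U)"
    by (intro open_vimage assms continuous_flip)
  have "x \<in> closure (flip F -` U)" for x
    unfolding closure_iff_nhds_not_empty
  proof (intro allI impI)
    fix A V assume V: "V \<subseteq> A" "open V" "x \<in> V"
    have "open (flip F -` V)"
      by (intro open_vimage V continuous_flip)
    moreover have "flip F x \<in> flip F -` V"
      using V by simp
    ultimately have "flip F -` V \<inter> U \<noteq> {}"
      using assms(2) open_Int_closure_eq_empty[of "flip F -` V" U] by blast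
    then obtain u where "u \<in> U" "flip F u \<in> V"
      by auto
    then have "flip F u \<in> flip F -` U \<inter> A"
      using V by auto
    then show "flip F -` U \<inter> A \<noteq> {}"
      by blast
  qed
  then show "closure (flip F -` U) = UNIV"
    by blast
qed

text \<open>\<open>E0\<close> is the orbit relation of the countable group of finite flips.
  Replacing the dense open sets by all their preimages under these flips keeps the family countable
  and makes the intersection invariant.\<close>

lemma residual_E0_invariant:
  assumes "residual P"
  obtains U :: "nat \<Rightarrow> cantor set"
  where "\<And>n. open (U n)" "\<And>n. closure (U n) = UNIV" "(\<Inter>n. U n) \<subseteq> P"
    "\<And>x y. x \<in> (\<Inter>n. U n) \<Longrightarrow> (x, y) \<in> E0 \<Longrightarrow> y \<in> (\<Inter>n. U n)"
proof -
  obtain \<U> where \<U>: "countable \<U>" "\<And>U. U \<in> \<U> \<Longrightarrow> open U \<and> closure U = UNIV" "\<Inter>\<U> \<subseteq> P"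
    using assms unfolding residual_def by blast
  \<comment> \<open>Inserting \<open>UNIV\<close> keeps the family nonempty, so that
    \<open>from_nat_into\<close> enumerates exactly \<open>\<V>\<close>.\<close>
  define \<V> where "\<V> = (\<lambda>(F, U). flip F -` U) ` ({F. finite F} \<times> insert UNIV \<U>)"
  have "countable \<V>"
    unfolding \<V>_def by (intro countable_image countable_SIGMA countable_Collect_finite) (simp add: \<U>)
  moreover have "\<V> \<noteq> {}"
    unfolding \<V>_def by auto
  ultimately have range: "range (from_nat_into \<V>) = \<V>"
    by simp
  define U where "U = from_nat_into \<V>"
  note range = range[folded U_def]
  have dense: "open V \<and> closure V = UNIV" if "V \<in> \<V>" for V
    using that \<U>(2) unfolding \<V>_def by (auto intro!: dense_vimage_flip)
  show thesis
  proof (rule that[of U])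
    show "open (U n)" "closure (U n) = UNIV" for n
      using dense range by blast+
    have eq: "(\<Inter>n. U n) = {x. \<forall>F. finite F \<longrightarrow> flip F x \<in> \<Inter>\<U>}"
      unfolding range by (auto simp: \<V>_def)
    have "flip {} x = x" for x
      by (simp add: flip_def)
    then show "(\<Inter>n. U n) \<subseteq> P"
      using \<U>(3) unfolding eq by (metis (mono_tags, lifting) finite.emptyI mem_Collect_eq subset_iff)
    show "y \<in> (\<Inter>n. U n)" if "x \<in> (\<Inter>n. U n)" "(x, y) \<in> E0" for x y
    proof -
      have "flip F y \<in> \<Inter>\<U>" if F: "finite F" for F
      proof -
        have "(y, flip F y) \<in> E0"
          unfolding E0_iff_flip using F by blast
        then have "(x, flip F y) \<in> E0"
          using E0_trans \<open>(x, y) \<in> E0\<close> by blast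
        then show ?thesis
          using \<open>x \<in> (\<Inter>n. U n)\<close> unfolding eq E0_iff_flip by auto
      qed
      then show ?thesis
        unfolding eq by blast
    qed
  qed
qed

section \<open>The Baire category theorem for Cantor space\<close>

lemma cantor_Baire:
  fixes U :: "nat \<Rightarrow> cantor set"
  assumes "\<And>n. open (U n)" "\<And>n. closure (U n) = UNIV"
  shows "(\<Inter>n. U n) \<noteq> {}"
proof -
  have "compact_space (euclidean :: bool topology)"
    by (simp add: compact_space_def finite_imp_compact)
  moreover have "Hausdorff_space (euclidean :: bool topology)"
    unfolding Hausdorff_space_def disjnt_def by (metis hausdorff open_openin)
  ultimately have fin: "compact_space (euclidean :: bool topology)" "Hausdorff_space (euclidean :: bool topology)"
    by auto
  have eq: "(euclidean :: cantor topology) = product_topology (\<lambda>_. euclidean) UNIV"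
    by (simp add: euclidean_product_topology)
  have "compact_space (euclidean :: cantor topology)"
    unfolding eq by (simp add: compact_space_product_topology fin)
  moreover have "Hausdorff_space (euclidean :: cantor topology)"
    unfolding eq by (simp add: Hausdorff_space_product_topology fin)
  ultimately have "locally_compact_space (euclidean :: cantor topology) \<and> regular_space (euclidean :: cantor topology)"
    using compact_imp_locally_compact_space compact_Hausdorff_imp_regular_space by blast
  then have "euclidean closure_of \<Inter>(range U) = topspace euclidean"
    using assms by (intro Baire_category) auto
  then show ?thesis
    by auto
qed

section \<open>Analytic sets\<close>

lemma Sigma11_fst_image: "closed C \<Longrightarrow> Sigma11 (fst ` (C :: ('a::topological_space \<times> baire) set))"
  unfolding Sigma11_def by blast

lemma continuous_reindex: "continuous_on UNIV (\<lambda>c n. c (g n) :: 'a::topological_space)"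
  by (rule continuous_on_coordinatewise_then_product) (rule continuous_on_product_coordinates)

lemma closed_coordinate: "closed {c. P (c n :: 'a::discrete_topology)}"
proof -
  have "closed ((\<lambda>c. c n) -` {a. P a})"
    by (intro closed_vimage continuous_on_product_coordinates) (simp add: closed_def open_discrete)
  then show ?thesis
    by (simp add: vimage_def)
qed

text \<open>Serves to combine projections: \<open>h\<close> picks out a part of the point,
  \<open>g\<close> the entries of the witness that carry one sub-witness.\<close>

lemma closed_vimage_reindex:
  fixes C :: "('a::topological_space \<times> baire) set"
  assumes "closed C" "continuous_on UNIV h"
  shows "closed {q. (h (fst q), \<lambda>n. snd q (g n)) \<in> C}"
proof -
  have "closed ((\<lambda>q. (h (fst q), \<lambda>n. snd q (g n))) -` C)"
    by (intro closed_vimage assms continuous_on_Pair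
        continuous_on_compose2[OF assms(2) continuous_on_fst] continuous_on_compose2[OF continuous_reindex continuous_on_snd]
        continuous_on_id) auto
  then show ?thesis
    by (simp add: vimage_def)
qed

lemma closed_Collect_snd: "closed {c. P c} \<Longrightarrow> closed {q. P (snd q)}"
  using closed_vimage_snd[of "{c. P c}"] by (simp add: vimage_def)

lemma closed_Collect_fst: "closed {c. P c} \<Longrightarrow> closed {q. P (fst q)}"
  using closed_vimage_fst[of "{c. P c}"] by (simp add: vimage_def)

lemma Sigma11_Un:
  assumes "Sigma11 A" "Sigma11 B"
  shows "Sigma11 (A \<union> B)"
proof -
  obtain C D :: "('a \<times> baire) set" where CD: "closed C" "A = fst ` C" "closed D" "B = fst ` D"
    using assms unfolding Sigma11_def by blast
  \<comment> \<open>Entry 0 of the witness tells which of the two sets is meant; the shifted rest is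
    a witness for that set.\<close>
  define E where "E = {q. snd q 0 = 0 \<and> (fst q, \<lambda>n. snd q (Suc n)) \<in> C
    \<or> snd q 0 \<noteq> 0 \<and> (fst q, \<lambda>n. snd q (Suc n)) \<in> D}"
  have "closed E"
    unfolding E_def
    by (intro closed_Collect_disj closed_Collect_conj CD
        closed_vimage_reindex[where h = "\<lambda>x. x"] continuous_on_id
        closed_Collect_snd[of "\<lambda>c. c 0 = 0"] closed_Collect_snd[of "\<lambda>c. c 0 \<noteq> 0"]
        closed_coordinate[of "\<lambda>k. k = 0"] closed_coordinate[of "\<lambda>k. k \<noteq> 0"])
  moreover have "A \<union> B = fst ` E"
  proof (intro equalityI subsetI)
    fix x assume "x \<in> A \<union> B"
    then consider c where "(x, c) \<in> C" | c where "(x, c) \<in> D"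
      using CD by auto
    then show "x \<in> fst ` E"
    proof cases
      case 1
      then show ?thesis
        by (intro image_eqI[of _ _ "(x, case_nat 0 c)"]) (simp_all add: E_def)
    next
      case 2
      then show ?thesis
        by (intro image_eqI[of _ _ "(x, case_nat 1 c)"]) (simp_all add: E_def)
    qed
  next
    fix x assume "x \<in> fst ` E"
    then show "x \<in> A \<union> B"
      unfolding E_def CD by force
  qed
  ultimately show ?thesis
    by (simp add: Sigma11_fst_image)
qed

lemma Sigma11_Times:
  fixes A :: "'a::topological_space set" and B :: "'b::topological_space set"
  assumes "Sigma11 A" "Sigma11 B"
  shows "Sigma11 (A \<times> B)"
proof -
  obtain C :: "('a \<times> baire) set" and D :: "('b \<times> baire) set"
    where CD: "closed C" "A = fst ` C" "closed D" "B = fst ` D"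
    using assms unfolding Sigma11_def by blast
  \<comment> \<open>The even and the odd entries of the witness serve the two factors.\<close>
  define E where "E = {q. (fst (fst q), \<lambda>n. snd q (2 * n)) \<in> C \<and> (snd (fst q), \<lambda>n. snd q (2 * n + 1)) \<in> D}"
  have "closed E"
    unfolding E_def
    by (intro closed_Collect_conj CD closed_vimage_reindex continuous_on_fst continuous_on_snd continuous_on_id)
  moreover have "A \<times> B = fst ` E"
  proof (intro equalityI subsetI)
    fix p assume "p \<in> A \<times> B"
    then obtain x y c d where p: "p = (x, y)" "(x, c) \<in> C" "(y, d) \<in> D"
      using CD by auto
    define e where "e n = (if even n then c (n div 2) else d (n div 2))" for n
    have "(p, e) \<in> E"
      using p by (simp add: E_def e_def)
    then show "p \<in> fst ` E"
      by force
  next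
    fix p assume "p \<in> fst ` E"
    then show "p \<in> A \<times> B"
      unfolding E_def CD by (force simp: mem_Times_iff)
  qed
  ultimately show ?thesis
    by (simp add: Sigma11_fst_image)
qed

lemma Sigma11_singleton_cantor: "Sigma11 {\<lambda>_ :: nat. b :: bool}"
proof -
  have "closed {w :: cantor. \<forall>n. w n = b}"
    by (intro closed_Collect_all closed_coordinate[of "\<lambda>a. a = b"])
  then have "closed ({w :: cantor. \<forall>n. w n = b} \<times> (UNIV :: baire set))"
    by (intro closed_Times closed_UNIV)
  moreover have "{\<lambda>_ :: nat. b} = fst ` ({w. \<forall>n. w n = b} \<times> (UNIV :: baire set))"
    by (auto simp: fun_eq_iff)
  ultimately show ?thesis
    by (metis Sigma11_fst_image)
qed

lemma Sigma11_Compl_singleton_cantor: "Sigma11 (- {\<lambda>_ :: nat. b :: bool})"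
proof -
  \<comment> \<open>Entry 0 of the witness names a coordinate at which the sequence is not
    \<open>b\<close>. Quantifying over all \<open>n\<close> instead of writing
    \<open>fst q (snd q 0)\<close> exhibits an intersection of closed conditions.\<close>
  define E :: "(cantor \<times> baire) set" where "E = {q. \<forall>n. snd q 0 \<noteq> n \<or> fst q n \<noteq> b}"
  have "closed E"
    unfolding E_def
    by (intro closed_Collect_all closed_Collect_disj closed_Collect_snd closed_Collect_fst
        closed_coordinate[of "\<lambda>k. k \<noteq> _"])
  moreover have "- {\<lambda>_ :: nat. b} = fst ` E"
  proof (intro equalityI subsetI)
    fix w assume "w \<in> - {\<lambda>_ :: nat. b}"
    then obtain n where "w n \<noteq> b"
      by auto
    then show "w \<in> fst ` E"
      by (intro image_eqI[of _ _ "(w, \<lambda>_. n)"]) (auto simp: E_def)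
  qed (auto simp: E_def)
  ultimately show ?thesis
    by (metis Sigma11_fst_image)
qed

text \<open>The graph and its complement are both unions of products of \<open>S\<close> or
  \<open>- S\<close> with a singleton or the complement of one.\<close>

lemma Delta11_fun_indicator:
  assumes "Sigma11 S" "Sigma11 (- S)"
  shows "Delta11_fun (\<lambda>p (_ :: nat). p \<in> S)"
proof -
  have graph: "{(p, w). w = (\<lambda>_ :: nat. p \<in> S)} = S \<times> {\<lambda>_. True} \<union> (- S) \<times> {\<lambda>_. False}"
    by auto
  have "- {(p, w). w = (\<lambda>_ :: nat. p \<in> S)} = S \<times> (- {\<lambda>_. True}) \<union> (- S) \<times> (- {\<lambda>_. False})"
    by (auto simp: fun_eq_iff)
  moreover have "Sigma11 (S \<times> {\<lambda>_ :: nat. True} \<union> (- S) \<times> {\<lambda>_. False})"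
    by (intro Sigma11_Un Sigma11_Times Sigma11_singleton_cantor assms)
  moreover have "Sigma11 (S \<times> (- {\<lambda>_ :: nat. True}) \<union> (- S) \<times> (- {\<lambda>_. False}))"
    by (intro Sigma11_Un Sigma11_Times Sigma11_Compl_singleton_cantor assms)
  ultimately show ?thesis
    using graph by (simp add: Delta11_fun_def Delta11_def Pi11_def)
qed

lemma Sigma11_infinitely_often:
  fixes R :: "nat \<Rightarrow> 'a::topological_space set"
  assumes "\<And>n. closed (R n)"
  shows "Sigma11 {p. infinite {n. p \<in> R n}}"
proof -
  \<comment> \<open>The witness maps each \<open>n\<close> to an index \<open>k \<ge> n\<close> with
    \<open>fst q \<in> R k\<close>; the quantifier over \<open>k\<close> again avoids evaluating at
    a witness entry.\<close>
  define E where "E = {q. \<forall>n k. snd q n \<noteq> k \<or> (n \<le> k \<and> fst q \<in> R k)}"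
  have "closed E"
    unfolding E_def
    by (intro closed_Collect_all closed_Collect_disj closed_Collect_conj closed_Collect_const
        closed_Collect_snd closed_Collect_fst closed_coordinate[of "\<lambda>k. k \<noteq> _"]) (simp add: assms)
  moreover have "{p. infinite {n. p \<in> R n}} = fst ` E"
  proof (intro equalityI subsetI)
    fix p assume "p \<in> {p. infinite {n. p \<in> R n}}"
    then have "\<forall>n. \<exists>k. n \<le> k \<and> p \<in> R k"
      by (auto simp: infinite_nat_iff_unbounded_le)
    then obtain c where "\<And>n. n \<le> c n \<and> p \<in> R (c n)"
      by metis
    then show "p \<in> fst ` E"
      by (intro image_eqI[of _ _ "(p, c)"]) (auto simp: E_def)
  qed (auto simp: E_def infinite_nat_iff_unbounded_le)
  ultimately show ?thesis
    by (simp add: Sigma11_fst_image)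
qed

lemma Sigma11_finitely_often:
  fixes R :: "nat \<Rightarrow> 'a::topological_space set"
  assumes "\<And>n. open (R n)"
  shows "Sigma11 {p. finite {n. p \<in> R n}}"
proof -
  \<comment> \<open>Entry 0 of the witness is a strict bound for the indices \<open>n\<close> with
    \<open>fst q \<in> R n\<close>.\<close>
  define E :: "('a \<times> baire) set" where "E = {q. \<forall>m n. snd q 0 \<noteq> m \<or> n < m \<or> fst q \<in> - R n}"
  have "closed E"
    unfolding E_def
    by (intro closed_Collect_all closed_Collect_disj closed_Collect_const
        closed_Collect_snd closed_Collect_fst closed_coordinate[of "\<lambda>k. k \<noteq> _"])
      (simp add: assms closed_Compl flip: Compl_eq)
  moreover have "{p. finite {n. p \<in> R n}} = fst ` E"
  proof (intro equalityI subsetI)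
    fix p assume "p \<in> {p. finite {n. p \<in> R n}}"
    then obtain m where "\<And>n. p \<in> R n \<Longrightarrow> n < m"
      by (auto simp: finite_nat_set_iff_bounded)
    then show "p \<in> fst ` E"
      by (intro image_eqI[of _ _ "(p, \<lambda>_. m)"]) (auto simp: E_def)
  qed (auto simp: E_def finite_nat_set_iff_bounded)
  ultimately show ?thesis
    by (simp add: Sigma11_fst_image)
qed

section \<open>The function \<open>K\<close> and its complexity\<close>

definition K :: "cantor \<times> cantor \<times> cantor \<Rightarrow> cantor" where
  "K = (\<lambda>(x, y, z) _. infinite {n. x n = y n \<and> y n \<noteq> z n})"

lemma K_apply: "K (x, y, z) = (\<lambda>_. infinite {n. x n = y n \<and> y n \<noteq> z n})"
  by (simp add: K_def)

lemma Delta11_fun_K: "Delta11_fun K"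
proof -
  define R :: "nat \<Rightarrow> (cantor \<times> cantor \<times> cantor) set"
    where "R n = {p. fst p n = fst (snd p) n \<and> fst (snd p) n \<noteq> snd (snd p) n}" for n
  \<comment> \<open>Bits are discrete, so any relation between three of them is a closed condition.
    Using this for a relation and for its negation makes \<open>R n\<close> clopen.\<close>
  have clopen: "closed {p :: cantor \<times> cantor \<times> cantor. P (fst p n) (fst (snd p) n) (snd (snd p) n)}" for P n
  proof -
    have eq: "{p :: cantor \<times> cantor \<times> cantor. P (fst p n) (fst (snd p) n) (snd (snd p) n)} =
       {p. \<forall>a b c. fst p n \<noteq> a \<or> fst (snd p) n \<noteq> b \<or> snd (snd p) n \<noteq> c \<or> P a b c}"
      by blast
    show ?thesis
      unfolding eq
      by (intro closed_Collect_all closed_Collect_disj closed_Collect_const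
          closed_Collect_fst[of "\<lambda>x. x n \<noteq> _"] closed_Collect_snd[of "\<lambda>p. fst p n \<noteq> _"] closed_Collect_snd[of "\<lambda>p. snd p n \<noteq> _"]
          closed_Collect_snd[of "\<lambda>x. x n \<noteq> _"] closed_coordinate[of "\<lambda>k. k \<noteq> _"])
  qed
  have "closed (R n)" "open (R n)" for n
    using clopen[of "\<lambda>a b c. a = b \<and> b \<noteq> c" n] clopen[of "\<lambda>a b c. \<not> (a = b \<and> b \<noteq> c)" n]
    by (simp_all add: R_def open_closed Compl_eq)
  then have "Sigma11 {p. infinite {n. p \<in> R n}}" "Sigma11 {p. finite {n. p \<in> R n}}"
    by (intro Sigma11_infinitely_often Sigma11_finitely_often; simp)+
  moreover have "- {p. infinite {n. p \<in> R n}} = {p. finite {n. p \<in> R n}}"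
    by auto
  moreover have "K = (\<lambda>p _. p \<in> {p. infinite {n. p \<in> R n}})"
    by (auto simp: fun_eq_iff K_def R_def)
  ultimately show ?thesis
    using Delta11_fun_indicator by metis
qed

section \<open>Triples with disjoint difference sets\<close>

text \<open>A flip at stage \<open>k\<close> changes the image only from \<open>a k\<close> on, and
  only finitely far because \<open>f\<close> preserves \<open>E0\<close>. The next flip is placed so
  far out that it cannot affect the image before that change is over. So on each block just one of
  \<open>f x\<close> and \<open>f y\<close> can depart from \<open>f z\<close>.\<close>

lemma disjoint_differences:
  fixes f :: "cantor \<Rightarrow> cantor" and U :: "nat \<Rightarrow> cantor set"
  defines "G \<equiv> (\<Inter>n. U n)"
  assumes open_U: "\<And>n. open (U n)"
    and inv: "\<And>x y. x \<in> G \<Longrightarrow> (x, y) \<in> E0 \<Longrightarrow> y \<in> G"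
    and cont: "continuous_on G f"
    and hom: "\<And>x y. (x, y) \<in> E0 \<Longrightarrow> (f x, f y) \<in> E0"
    and z: "z \<in> G"
  obtains x y where "x \<in> G" "y \<in> G" "(x, y) \<notin> E0" "(x, z) \<notin> E0" "(y, z) \<notin> E0"
    "finite {n. f x n = f y n \<and> f y n \<noteq> f z n}"
proof -
  \<comment> \<open>\<open>f v\<close> agrees with \<open>f z\<close> from \<open>a\<close> on, and changes of \<open>v\<close> from \<open>m\<close> on stay in \<open>U k\<close> and do not
    affect \<open>f v\<close> below \<open>a\<close>. So the flips of stage \<open>k\<close> only matter on the block from \<open>a k\<close> to \<open>a (Suc k)\<close>.\<close>
  define good where "good k v m a \<longleftrightarrow> k \<le> a \<and> (\<forall>n\<ge>a. f v n = f z n) \<and>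
    (\<forall>w. (\<forall>i<m. w i = v i) \<longrightarrow> w \<in> U k \<and> (w \<in> G \<longrightarrow> (\<forall>n<a. f w n = f v n)))" for k v m a
  \<comment> \<open>The bound \<open>a\<close> precedes \<open>m\<close> because the modulus of
    continuity depends on it. Both may be increased at will, so \<open>v True\<close> and
    \<open>v False\<close> can later share them.\<close>
  have ex_good: "\<exists>a0. \<forall>a\<ge>a0. \<exists>m0. \<forall>m\<ge>m0. good k v m a" if v: "(z, v) \<in> E0" for k v
  proof -
    obtain N where N: "\<And>n. n > N \<Longrightarrow> f z n = f v n"
      using hom[OF v] by (auto simp: E0_def)
    have "v \<in> G"
      using inv z v by blast
    show ?thesis
    \<comment> \<open>\<open>Suc\<close> is there because agreement holds only strictly above
      \<open>N\<close>; adding \<open>k\<close> secures \<open>k \<le> a\<close>.\<close>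
    proof (rule exI[of _ "Suc (N + k)"], intro allI impI)
      fix a assume a: "Suc (N + k) \<le> a"
      have "v \<in> U k"
        using \<open>v \<in> G\<close> by (simp add: G_def)
      then obtain m1 where m1: "\<And>w. (\<And>i. i < m1 \<Longrightarrow> w i = v i) \<Longrightarrow> w \<in> U k"
        using open_contains_cylinder[OF open_U] by blast
      obtain m2 where m2: "\<And>w n. w \<in> G \<Longrightarrow> (\<And>i. i < m2 \<Longrightarrow> w i = v i) \<Longrightarrow> n < a \<Longrightarrow> f w n = f v n"
        using continuous_on_cantor_cylinder[OF cont \<open>v \<in> G\<close>] by blast
      have "good k v m a" if "m1 + m2 \<le> m" for m
        unfolding good_def
      proof (intro conjI allI impI)
        show "k \<le> a"
          using a by simp
        show "f v n = f z n" if "a \<le> n" for n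
          using N[of n] that a by simp
        fix w assume "\<forall>i<m. w i = v i"
        then have w: "w i = v i" if "i < m1 + m2" for i
          using that \<open>m1 + m2 \<le> m\<close> by simp
        show "w \<in> U k"
          by (rule m1) (simp add: w)
        show "f w n = f v n" if "w \<in> G" "n < a" for n
          by (rule m2) (simp_all add: w that)
      qed
      then show "\<exists>m0. \<forall>m\<ge>m0. good k v m a"
        by blast
    qed
  qed
  \<comment> \<open>A state consists of \<open>v True\<close> and \<open>v False\<close>, the stages
    of \<open>x\<close> and \<open>y\<close>, of the position \<open>m\<close> of the next flip, and
    of \<open>a\<close>. Even stages flip \<open>v True\<close>, odd ones \<open>v False\<close>.
    The clause for \<open>k = 0\<close> fixes the start, as the choice principle says of the initial
    state only that it satisfies \<open>P 0\<close>.\<close>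
  define P :: "nat \<Rightarrow> (bool \<Rightarrow> cantor) \<times> nat \<times> nat \<Rightarrow> bool" where
    "P k = (\<lambda>(v, m, a). (k = 0 \<longrightarrow> v = (\<lambda>_. z)) \<and> (\<forall>b. (z, v b) \<in> E0 \<and> good k (v b) m a))" for k
  define Q :: "nat \<Rightarrow> (bool \<Rightarrow> cantor) \<times> nat \<times> nat \<Rightarrow> (bool \<Rightarrow> cantor) \<times> nat \<times> nat \<Rightarrow> bool" where
    "Q k = (\<lambda>(v, m, a) (v', m', a'). v' = v(even k := flip {m} (v (even k))) \<and> m < m')" for k
  have ex_P: "\<exists>m a. l < m \<and> (\<forall>b. good k (v b) m a)" if v: "\<And>b. (z, v b) \<in> E0" for k l and v :: "bool \<Rightarrow> cantor"
  proof -
    obtain a0 where a0: "\<And>b a. a \<ge> a0 b \<Longrightarrow> \<exists>m0. \<forall>m\<ge>m0. good k (v b) m a"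
      using ex_good[OF v] by metis
    define a where "a = a0 True + a0 False"
    have "a0 b \<le> a" for b
      by (cases b) (simp_all add: a_def)
    then have "\<exists>m0. \<forall>m\<ge>m0. good k (v b) m a" for b
      using a0 by simp
    then obtain m0 where m0: "\<And>b m. m \<ge> m0 b \<Longrightarrow> good k (v b) m a"
      by metis
    have "good k (v b) (Suc (l + m0 True + m0 False)) a" for b
      by (rule m0) (cases b; simp)
    then show ?thesis
      by (intro exI[of _ "Suc (l + m0 True + m0 False)"] exI[of _ a]) simp
  qed
  have "\<exists>s. \<forall>k. P k (s k) \<and> Q k (s k) (s (Suc k))"
  proof (rule dependent_nat_choice)
    have "(z, z) \<in> E0"
      by (simp add: E0_def)
    then show "\<exists>s. P 0 s"
      using ex_P[of "\<lambda>_. z" 0 0] by (auto simp: P_def)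
  next
    fix s k assume "P k s"
    obtain v m a where s: "s = (v, m, a)"
      by (cases s)
    define v' where "v' = v(even k := flip {m} (v (even k)))"
    have "(x, flip {m} x) \<in> E0" for x
      unfolding E0_iff_flip by blast
    moreover have "(z, v b) \<in> E0" for b
      using \<open>P k s\<close> by (simp add: P_def s)
    ultimately have "(z, v' b) \<in> E0" for b
      by (metis E0_trans fun_upd_apply v'_def)
    then obtain m' a' where "m < m'" "\<And>b. good (Suc k) (v' b) m' a'"
      using ex_P by blast
    with \<open>\<And>b. (z, v' b) \<in> E0\<close> show "\<exists>s'. P (Suc k) s' \<and> Q k s s'"
      by (intro exI[of _ "(v', m', a')"]) (auto simp: P_def Q_def s v'_def)
  qed
  then obtain s where s: "\<And>k. P k (s k)" "\<And>k. Q k (s k) (s (Suc k))"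
    by blast
  define v where "v k = fst (s k)" for k
  define m where "m k = fst (snd (s k))" for k
  define a where "a k = snd (snd (s k))" for k
  have s_eq: "s k = (v k, m k, a k)" for k
    by (simp add: v_def m_def a_def)
  have v0: "v 0 = (\<lambda>_. z)" and good: "\<And>k b. good k (v k b) (m k) (a k)"
    using s(1) by (simp_all add: s_eq P_def)
  have v_Suc: "v (Suc k) = (v k)(even k := flip {m k} (v k (even k)))" and "m k < m (Suc k)" for k
    using s(2)[of k] by (simp_all add: s_eq Q_def)
  then have mono: "strict_mono m"
    by (simp add: strict_mono_Suc_iff)
  \<comment> \<open>Since \<open>m\<close> is strictly increasing, no position is flipped twice and
    so no flip is undone.\<close>
  have v_eq: "v k b i \<longleftrightarrow> z i \<noteq> (\<exists>j<k. even j = b \<and> m j = i)" for k b i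
  proof (induction k)
    case (Suc k)
    have "m j \<noteq> m k" if "j < k" for j
      using that mono by (metis strict_mono_less less_irrefl)
    then show ?case
      using Suc by (auto simp: v_Suc flip_def less_Suc_eq)
  qed (simp add: v0)
  define X where "X b = (\<lambda>i. z i \<noteq> (\<exists>j. even j = b \<and> m j = i))" for b
  have X_v: "X b i = v k b i" if "i < m k" for b i k
    using that mono by (auto simp: X_def v_eq strict_mono_less)
  \<comment> \<open>Membership in every \<open>U k\<close> must come first: \<open>good\<close>
    provides it for arbitrary \<open>w\<close>. Only then does its clause on points of
    \<open>G\<close> apply to \<open>X b\<close>.\<close>
  have X_G: "X b \<in> G" for b
    using good[of _ b] X_v[of _ _ b] unfolding G_def good_def by blast
  have f_X: "f (X b) n = f (v k b) n" if "n < a k" for b n k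
    using good[of k b] X_v[of _ k b] X_G[of b] that unfolding good_def by blast
  have X_m: "X (even j) (m j) \<noteq> z (m j)" "X (odd j) (m j) = z (m j)" for j
    using mono by (auto simp: X_def strict_mono_eq)
  have late: "\<exists>j. even j = b \<and> n < m j" for b n
  proof -
    define j where "j = 2 * n + 2 + (if b then 0 else 1)"
    have "n < j" "even j = b"
      by (auto simp: j_def)
    moreover have "j \<le> m j"
      by (rule strict_mono_imp_increasing[OF mono])
    ultimately show ?thesis
      by (meson less_le_trans)
  qed
  show thesis
  proof (rule that[of "X True" "X False"])
    have "(X b, z) \<notin> E0" for b
      using late[of b] X_m(1) unfolding E0_def by fastforce
    then show "(X True, z) \<notin> E0" "(X False, z) \<notin> E0"
      by auto
    have "\<exists>k>n. X True k \<noteq> X False k" for n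
      using late[of True n] X_m by (metis (full_types))
    then show "(X True, X False) \<notin> E0"
      unfolding E0_def by blast
    have "f (X True) n = f z n \<or> f (X False) n = f z n" if n: "a 0 \<le> n" for n
    proof -
      \<comment> \<open>The bound \<open>k \<le> a k\<close> makes \<open>a\<close> unbounded,
        though not necessarily increasing. The least \<open>k\<close> with \<open>n < a k\<close>
        yields \<open>a j \<le> n < a (Suc j)\<close>, and stage \<open>j\<close> leaves the
        component \<open>odd j\<close> alone.\<close>
      define k where "k = (LEAST k. n < a k)"
      have "Suc n \<le> a (Suc n)"
        using good[of "Suc n" True] unfolding good_def by blast
      then have k: "n < a k"
        unfolding k_def by (intro LeastI[of "\<lambda>k. n < a k" "Suc n"]) simp
      then obtain j where j: "k = Suc j"
        using n by (cases k) auto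
      then have "a j \<le> n"
        using not_less_Least[of j "\<lambda>k. n < a k"] k_def by simp
      then have "f (v j (odd j)) n = f z n"
        using good[of j "odd j"] unfolding good_def by blast
      moreover have "v k (odd j) = v j (odd j)"
        by (simp add: j v_Suc)
      ultimately have "f (X (odd j)) n = f z n"
        using f_X[OF k] by simp
      then show ?thesis
        by (cases "odd j") auto
    qed
    then have "{n. f (X True) n = f (X False) n \<and> f (X False) n \<noteq> f z n} \<subseteq> {..<a 0}"
      unfolding subset_iff lessThan_iff mem_Collect_eq by (metis not_le)
    then show "finite {n. f (X True) n = f (X False) n \<and> f (X False) n \<noteq> f z n}"
      by (rule finite_subset) simp
  qed (simp_all add: X_G)
qed

section \<open>Discontinuity\<close>

lemma K_E0_invariant:
  assumes "(x, x') \<in> E0" "(y, y') \<in> E0" "(z, z') \<in> E0"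
  shows "K (x, y, z) = K (x', y', z')"
proof -
  have *: "infinite {n. x' n = y' n \<and> y' n \<noteq> z' n}"
    if "infinite {n. x n = y n \<and> y n \<noteq> z n}" "(x, x') \<in> E0" "(y, y') \<in> E0" "(z, z') \<in> E0" for x y z x' y' z'
  proof
    assume "finite {n. x' n = y' n \<and> y' n \<noteq> z' n}"
    then have "finite ({n. x' n = y' n \<and> y' n \<noteq> z' n} \<union> {n. x n \<noteq> x' n} \<union> {n. y n \<noteq> y' n} \<union> {n. z n \<noteq> z' n})"
      using that by (simp add: E0_iff_finite)
    then have "finite {n. x n = y n \<and> y n \<noteq> z n}"
      by (rule rev_finite_subset) auto
    with that show False
      by blast
  qed
  then show ?thesis
    using *[OF _ assms] *[OF _ assms[THEN E0_sym]] by (auto simp: K_apply)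
qed

lemma E0_dense:
  obtains w where "\<And>n. (y, w n) \<in> E0" "w \<longlonglongrightarrow> (x :: cantor)"
proof
  define w where "w n = (\<lambda>i. if i < n then x i else y i)" for n
  have "\<forall>k>n. y k = w n k" for n
    by (simp add: w_def)
  then show "(y, w n) \<in> E0" for n
    unfolding E0_def by blast
  show "w \<longlonglongrightarrow> x"
  proof (rule topological_tendstoI)
    fix S assume "open S" "x \<in> S"
    then obtain m where "\<And>w. (\<And>i. i < m \<Longrightarrow> w i = x i) \<Longrightarrow> w \<in> S"
      using open_contains_cylinder by blast
    then have "w n \<in> S" if "m \<le> n" for n
      using that by (simp add: w_def)
    then show "\<forall>\<^sub>F n in sequentially. w n \<in> S"
      unfolding eventually_sequentially by blast
  qed
qed

lemma not_continuous_on_K: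
  assumes "Delta11_reducible E0 (Restr E0 A)"
  shows "\<not> continuous_on (triples E0 A) K"
proof
  assume cont_K: "continuous_on (triples E0 A) K"
  obtain f :: "cantor \<Rightarrow> cantor" where f: "Delta11_fun f" "\<And>a b. (a, b) \<in> E0 \<longleftrightarrow> (f a, f b) \<in> Restr E0 A"
    using assms unfolding Delta11_reducible_def by blast
  have "(x, x) \<in> E0" for x
    by (simp add: E0_def)
  then have f_A: "f x \<in> A" for x
    using f(2) by blast
  have f_E0: "(x, y) \<in> E0 \<longleftrightarrow> (f x, f y) \<in> E0" for x y
    using f(2)[of x y] f_A by blast
  obtain P where "residual P" "continuous_on P f"
    by (rule borel_continuous_on_residual[OF Delta11_fun_coordinate_borel[OF f(1)]])
  obtain U :: "nat \<Rightarrow> cantor set"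
    where U: "\<And>n. open (U n)" "\<And>n. closure (U n) = UNIV" "(\<Inter>n. U n) \<subseteq> P"
      "\<And>x y. x \<in> (\<Inter>n. U n) \<Longrightarrow> (x, y) \<in> E0 \<Longrightarrow> y \<in> (\<Inter>n. U n)"
    by (rule residual_E0_invariant[OF \<open>residual P\<close>]) (rule that)
  define G where "G = (\<Inter>n. U n)"
  have cont_f: "continuous_on G f"
    using \<open>continuous_on P f\<close> U(3) unfolding G_def by (rule continuous_on_subset)
  have inv: "\<And>x y. x \<in> G \<Longrightarrow> (x, y) \<in> E0 \<Longrightarrow> y \<in> G"
    unfolding G_def by (rule U(4))
  obtain z where z: "z \<in> G"
    using cantor_Baire[of U, OF U(1,2)] unfolding G_def by (meson ex_in_conv)
  have hom: "\<And>x y. (x, y) \<in> E0 \<Longrightarrow> (f x, f y) \<in> E0"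
    using f_E0 by blast
  obtain x y where xy: "x \<in> G" "y \<in> G" "(x, y) \<notin> E0" "(x, z) \<notin> E0" "(y, z) \<notin> E0"
    and fin: "finite {n. f x n = f y n \<and> f y n \<noteq> f z n}"
    by (rule disjoint_differences[of U f z, folded G_def])
      (rule U(1) cont_f z | erule (1) inv | erule hom | rule that; assumption)+
  have K_xyz: "K (f x, f y, f z) = (\<lambda>_. False)"
    using fin by (simp add: K_apply)
  \<comment> \<open>Where \<open>f x\<close> and \<open>f z\<close> differ, the bit of
    \<open>f y\<close> equals one of theirs, so the two sets together cover an infinite set.\<close>
  have "infinite {n. f y n = f z n \<and> f z n \<noteq> f x n}"
  proof
    assume "finite {n. f y n = f z n \<and> f z n \<noteq> f x n}"
    with fin have "finite ({n. f x n = f y n \<and> f y n \<noteq> f z n} \<union> {n. f y n = f z n \<and> f z n \<noteq> f x n})"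
      by simp
    then have "finite {n. f x n \<noteq> f z n}"
      by (rule rev_finite_subset) auto
    then show False
      using xy(4) f_E0 by (simp add: E0_iff_finite)
  qed
  then have K_yzx: "K (f y, f z, f x) = (\<lambda>_. True)"
    by (simp add: K_apply)
  \<comment> \<open>As \<open>G\<close> is invariant, a sequence in the class of \<open>v\<close>
    that converges to \<open>u\<close> stays in \<open>G\<close>, where \<open>f\<close> is
    continuous.\<close>
  have approx: "\<exists>w. (\<forall>n. (v, w n) \<in> E0) \<and> (\<lambda>n. f (w n)) \<longlonglongrightarrow> f u" if "u \<in> G" "v \<in> G" for u v
  proof -
    obtain w where w: "\<And>n. (v, w n) \<in> E0" "w \<longlonglongrightarrow> u"
      using E0_dense by blast
    moreover have "w n \<in> G" for n
      using inv that(2) w(1) by blast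
    ultimately have "(\<lambda>n. f (w n)) \<longlonglongrightarrow> f u"
      using that(1) by (intro continuous_on_tendsto_compose[OF cont_f, of w] always_eventually allI)
    with w(1) show ?thesis
      by blast
  qed
  \<comment> \<open>The classes are shifted: points equivalent to \<open>y\<close>,
    \<open>z\<close>, \<open>x\<close> approach \<open>x\<close>, \<open>y\<close>,
    \<open>z\<close>. Along the sequence \<open>K\<close> then has its value at the shifted triple,
    by invariance, but the opposite value at the limit.\<close>
  obtain x' y' z' where lim: "(\<lambda>n. f (x' n)) \<longlonglongrightarrow> f x" "(\<lambda>n. f (y' n)) \<longlonglongrightarrow> f y" "(\<lambda>n. f (z' n)) \<longlonglongrightarrow> f z"
    and E: "\<And>n. (y, x' n) \<in> E0" "\<And>n. (z, y' n) \<in> E0" "\<And>n. (x, z' n) \<in> E0"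
    using approx[OF xy(1,2)] approx[OF xy(2) z] approx[OF z xy(1)] by blast
  have triple: "(f a, f b, f c) \<in> triples E0 A" if "(a, b) \<notin> E0" "(a, c) \<notin> E0" "(b, c) \<notin> E0" for a b c
    using that f_A f_E0 by (simp add: triples_def)
  have "(f (x' n), f (y' n), f (z' n)) \<in> triples E0 A" for n
    using E[of n] xy by (intro triple) (meson E0_sym E0_trans)+
  moreover have "(f x, f y, f z) \<in> triples E0 A"
    using xy by (intro triple)
  \<comment> \<open>All values of \<open>K\<close> are constant sequences, so coordinate 0 already
    shows the jump.\<close>
  ultimately have "(\<lambda>n. K (f (x' n), f (y' n), f (z' n)) 0) \<longlonglongrightarrow> K (f x, f y, f z) 0"
    by (intro continuous_on_tendsto_compose[OF continuous_on_product_then_coordinatewise[OF cont_K, of 0],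
          of "\<lambda>n. (f (x' n), f (y' n), f (z' n))"] tendsto_Pair lim always_eventually allI)
  moreover have "K (f (x' n), f (y' n), f (z' n)) = (\<lambda>_. True)" for n
    using K_E0_invariant[OF hom hom hom, OF E] K_yzx by metis
  ultimately have "(\<lambda>n :: nat. True) \<longlonglongrightarrow> False"
    using K_xyz by simp
  then show False
    using LIMSEQ_unique[OF tendsto_const] by blast
qed

theorem theorem9p5:
  shows "\<exists>K :: cantor \<times> cantor \<times> cantor \<Rightarrow> cantor. Delta11_fun K \<and>
    (\<forall>A :: cantor set. Sigma11 A \<and> Delta11_reducible E0 (Restr E0 A) \<longrightarrow>
       \<not> continuous_on (triples E0 A) K)"
  using Delta11_fun_K not_continuous_on_K by blast

end
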